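(* The inclusion $\ell_\infty\subset\ell_\infty^{\lambda}(\widehat F)$ holds and is strict.
   Context: $\mathbb N_0=\{0,1,2,\dots\}$; $\omega$ is the space of all real sequences $x=(x_k)_{k\in\mathbb N_0}$; $\ell_\infty$ is the space of bounded real sequences. Fibonacci numbers: $f_0=f_1=1$, $f_n=f_{n-1}+f_{n-2}$ for $n\ge 2$. $\lambda=(\lambda_k)_{k\in\mathbb N_0}$ is a fixed strictly increasing sequence of positive reals with $\lambda_k\to\infty$. Terms with negative subscript are $0$ (so $\lambda_{-1}=0$, $x_{-1}=0$). For $x\in\omega$ put $$E_n(x)=\frac1{\lambda_n}\sum_{k=0}^n(\lambda_k-\lambda_{k-1})\Big(\frac{f_k}{f_{k+1}}x_k-\frac{f_{k+1}}{f_k}x_{k-1}\Big),\qquad Ex=(E_n(x))_{n\in\mathbb N_0},$$ and $\ell_\infty^{\lambda}(\widehat F)=\{x\in\omega: Ex\in\ell_\infty\}$. *)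

theory Defs
  imports Complex_Main "HOL-Number_Theory.Fib"
begin

text \<open>The library sequence starts with \<open>fib 0 = 0\<close>, \<open>fib 1 = 1\<close>; the indexing
  \<open>f\<^sub>0 = f\<^sub>1 = 1\<close> used here is obtained by a shift.\<close>

definition fibo :: "nat \<Rightarrow> real" where
  "fibo n = real (fib (Suc n))"

lemma fibo_0: "fibo 0 = 1"
  by (simp add: fibo_def)

lemma fibo_1: "fibo 1 = 1"
  by (simp add: fibo_def)

lemma fibo_rec: "fibo (Suc (Suc n)) = fibo (Suc n) + fibo n"
  by (simp add: fibo_def)

text \<open>\<open>prev x k\<close> is \<open>x\<^bsub>k-1\<^esub>\<close>, with the convention that terms with negative
  subscript are \<open>0\<close>.\<close>

definition prev :: "(nat \<Rightarrow> real) \<Rightarrow> nat \<Rightarrow> real" where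
  "prev x k = (if k = 0 then 0 else x (k - 1))"

definition E :: "(nat \<Rightarrow> real) \<Rightarrow> (nat \<Rightarrow> real) \<Rightarrow> nat \<Rightarrow> real" where
  "E l x n = 1 / l n * (\<Sum>k=0..n. (l k - prev l k) *
     (fibo k / fibo (k + 1) * x k - fibo (k + 1) / fibo k * prev x k))"

definition ell_infty :: "(nat \<Rightarrow> real) set" where
  "ell_infty = {x. Bseq x}"

definition ell_infty_fib :: "(nat \<Rightarrow> real) \<Rightarrow> (nat \<Rightarrow> real) set" where
  "ell_infty_fib l = {x. E l x \<in> ell_infty}"

end

theory Submission
  imports Defs
begin

text \<open>The weights \<open>\<lambda>\<^sub>k - \<lambda>\<^bsub>k-1\<^esub>\<close> are nonnegative and sum to \<open>\<lambda>\<^sub>n\<close>, so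
  \<open>E\<^sub>n x\<close> is a weighted mean of the differences
  \<open>f\<^sub>k / f\<^bsub>k+1\<^esub> x\<^sub>k - f\<^bsub>k+1\<^esub> / f\<^sub>k x\<^bsub>k-1\<^esub>\<close>; hence \<open>E x\<close> is bounded whenever these
  differences are, and for bounded \<open>x\<close> they are, since the Fibonacci quotients are at most \<open>2\<close>.
  The unbounded sequence \<open>x\<^sub>k = f\<^bsub>k+1\<^esub>\<^sup>2\<close> makes all differences vanish
  except the one at \<open>k = 0\<close>, so the inclusion is strict.\<close>

lemma fibo_pos: "fibo k > 0"
  by (simp add: fibo_def fib_neq_0_nat)

lemma fibo_le_Suc: "fibo k \<le> fibo (Suc k)"
  using fib_mono[of "Suc k" "Suc (Suc k)"] by (simp add: fibo_def)

text \<open>By the recurrence and monotonicity, the summand added to \<open>fibo k\<close> is at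
  most \<open>fibo k\<close> itself.\<close>

lemma fibo_Suc_le: "fibo (Suc k) \<le> 2 * fibo k"
proof (cases k)
  case 0
  then show ?thesis using fibo_0 fibo_1 by simp
next
  case (Suc m)
  then show ?thesis using fibo_rec[of m] fibo_le_Suc[of m] by simp
qed

lemma fibo_Suc_ge: "fibo (Suc k) \<ge> real k + 1"
proof (induction k)
  case 0
  then show ?case using fibo_1 by simp
next
  case (Suc k)
  \<comment> \<open>\<open>fibo k\<close> is a positive integer, so each step of the recurrence adds
    at least 1.\<close>
  have "fibo k \<ge> 1"
    using fibo_pos[of k] by (simp add: fibo_def)
  then show ?case using Suc fibo_rec[of k] by simp
qed

text \<open>Telescoping; the convention \<open>prev l 0 = 0\<close> leaves no boundary term.\<close>

lemma sum_diff_prev: "(\<Sum>k=0..n. l k - prev l k) = l n"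
  by (induction n) (auto simp: prev_def)

lemma E_bounded:
  assumes "mono l" and pos: "\<And>k. l k > 0"
    and bound: "\<And>k. \<bar>fibo k / fibo (k + 1) * x k - fibo (k + 1) / fibo k * prev x k\<bar> \<le> B"
  shows "\<bar>E l x n\<bar> \<le> B"
proof -
  let ?d = "\<lambda>k. fibo k / fibo (k + 1) * x k - fibo (k + 1) / fibo k * prev x k"
  have weight: "l k - prev l k \<ge> 0" for k
    \<comment> \<open>At \<open>k = 0\<close> the weight is \<open>l 0\<close>, so positivity is
      used there and monotonicity elsewhere.\<close>
    using monoD[OF \<open>mono l\<close>, of "k - 1" k] pos[of k] by (auto simp: prev_def)
  have "\<bar>\<Sum>k=0..n. (l k - prev l k) * ?d k\<bar> \<le> (\<Sum>k=0..n. \<bar>(l k - prev l k) * ?d k\<bar>)"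
    by (rule sum_abs)
  also have "\<dots> \<le> (\<Sum>k=0..n. (l k - prev l k) * B)"
  proof (rule sum_mono)
    fix k
    show "\<bar>(l k - prev l k) * ?d k\<bar> \<le> (l k - prev l k) * B"
      unfolding abs_mult abs_of_nonneg[OF weight]
      by (rule mult_left_mono[OF bound weight])
  qed
  also have "\<dots> = l n * B"
    unfolding sum_distrib_right[symmetric] sum_diff_prev ..
  finally show ?thesis
    using pos[of n] by (simp add: E_def abs_mult divide_le_eq mult.commute)
qed

lemma ell_infty_subset:
  assumes "mono l" and "\<And>k. l k > 0"
  shows "ell_infty \<subseteq> ell_infty_fib l"
proof
  fix x assume "x \<in> ell_infty"
  then obtain K where K: "K > 0" "\<And>k. \<bar>x k\<bar> \<le> K"
    by (auto simp: ell_infty_def Bseq_def)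
  \<comment> \<open>The constant is 1 + 2: the quotients are at most 1 and 2 respectively.\<close>
  have "\<bar>fibo k / fibo (k + 1) * x k - fibo (k + 1) / fibo k * prev x k\<bar> \<le> 3 * K" for k
  proof -
    have "\<bar>prev x k\<bar> \<le> K"
      using K by (simp add: prev_def)
    moreover have "\<bar>fibo (k + 1) / fibo k\<bar> \<le> 2"
      using fibo_pos[of k] fibo_pos[of "Suc k"] fibo_Suc_le[of k] by (simp add: divide_le_eq)
    ultimately have "\<bar>fibo (k + 1) / fibo k * prev x k\<bar> \<le> 2 * K"
      unfolding abs_mult by (intro mult_mono) auto
    moreover have "\<bar>fibo k / fibo (k + 1)\<bar> \<le> 1"
      using fibo_pos[of k] fibo_pos[of "Suc k"] fibo_le_Suc[of k] by (simp add: divide_le_eq)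
    then have "\<bar>fibo k / fibo (k + 1) * x k\<bar> \<le> 1 * K"
      using K(2)[of k] unfolding abs_mult by (intro mult_mono) auto
    ultimately show ?thesis by linarith
  qed
  then have "\<bar>E l x n\<bar> \<le> 3 * K" for n
    by (rule E_bounded[OF assms])
  then show "x \<in> ell_infty_fib l"
    by (auto simp: ell_infty_fib_def ell_infty_def intro!: BseqI'[where K = "3 * K"])
qed

lemma fibo_squared_in_ell_infty_fib:
  assumes "mono l" and "\<And>k. l k > 0"
  shows "(\<lambda>k. (fibo (k + 1))\<^sup>2) \<in> ell_infty_fib l"
proof -
  let ?x = "\<lambda>k. (fibo (k + 1))\<^sup>2"
  have "\<bar>fibo k / fibo (k + 1) * ?x k - fibo (k + 1) / fibo k * prev ?x k\<bar> \<le> 1" for k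
  proof (cases k)
    case 0
    then show ?thesis using fibo_0 fibo_1 by (simp add: prev_def)
  next
    case (Suc m)
    \<comment> \<open>Here \<open>prev ?x k\<close> is the square of \<open>fibo k\<close>, so both
      terms equal \<open>fibo k * fibo (k + 1)\<close> and cancel.\<close>
    then show ?thesis
      using fibo_pos[of k] fibo_pos[of "Suc k"] by (simp add: prev_def power2_eq_square)
  qed
  then have "\<bar>E l ?x n\<bar> \<le> 1" for n
    by (rule E_bounded[OF assms])
  then show ?thesis
    by (auto simp: ell_infty_fib_def ell_infty_def intro!: BseqI'[where K = 1])
qed

lemma fibo_squared_notin_ell_infty: "(\<lambda>k. (fibo (k + 1))\<^sup>2) \<notin> ell_infty"
proof
  assume "(\<lambda>k. (fibo (k + 1))\<^sup>2) \<in> ell_infty"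
  then obtain K where K: "\<And>k. (fibo (k + 1))\<^sup>2 \<le> K"
    by (auto simp: ell_infty_def Bseq_def)
  obtain k :: nat where "K < real k"
    using reals_Archimedean2 by blast
  moreover have "real k + 1 \<le> fibo (k + 1)"
    using fibo_Suc_ge[of k] by simp
  \<comment> \<open>Squaring does not decrease a number that is at least 1, so linear growth of
    \<open>fibo\<close> already exceeds \<open>K\<close>.\<close>
  moreover from this have "fibo (k + 1) \<le> (fibo (k + 1))\<^sup>2"
    by (intro self_le_power) auto
  ultimately show False
    using K[of k] by linarith
qed

theorem theorem2p8:
  fixes l :: "nat \<Rightarrow> real"
  assumes "strict_mono l"
    and "\<And>k. l k > 0"
    and "filterlim l at_top sequentially"
  shows "ell_infty \<subset> ell_infty_fib l"
proof -
  have "mono l"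
    using assms(1) by (rule strict_mono_mono)
  then show ?thesis
    using ell_infty_subset fibo_squared_in_ell_infty_fib fibo_squared_notin_ell_infty assms(2)
    by blast
qed

end
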